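(* Let $\mathcal H$ be a real Hilbert space and $F=f+\Psi$, where $f:\mathcal H\to\mathbb R$ is twice continuously differentiable with $L$-Lipschitz continuous gradient for some $L>0$, and $\Psi:\mathcal H\to[-\infty,\infty]$ is convex, proper and closed. Assume that $F$ is lower bounded by some $\bar F>-\infty$. Consider the algorithm described in the context, with parameters $\beta,\gamma\in(0,1)$, $\nu\in[0,1)$, $\rho\in(0,1]$, $c>0$, $0\le\delta\le2$, and suppose that for all $t$ the operator $J_t$ is symmetric, positive semidefinite and satisfies $\|J_t-\nabla^2f(x_t)\|=O(r(x_t)^\theta)$ for some $\theta$ with $\rho\le\theta\le1$. Then either the algorithm terminates at some $x_t$ for which $r(x_t)=0$ (thus $x_t\in\mathcal S$), or else $$\lim_{t\to\infty}r(x_t)=0 .$$ If in addition $\mathcal S$ is nonempty, then any accumulation point of $\{x_t\}$ is in $\mathcal S$.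
   Context: Notation: $\operatorname{prox}_g(x)$ is the minimizer over $y\in\mathcal H$ of $\tfrac12\|y-x\|^2+g(y)$; $r(x):=\|x-\operatorname{prox}_\Psi(x-\nabla f(x))\|$; $\mathcal S:=\{x:r(x)=0\}$ is the set of stationary points of $F$; $\mathrm{Id}$ is the identity on $\mathcal H$. Algorithm. Input $x_0\in\mathcal H$, the Lipschitz constant $L$ and the parameters above. For $t=0,1,\dots$: (1) Let $g_t:=\nabla f(x_t)$, $\mu_t:=c\,r(x_t)^\rho$, $H_t:=J_t+\mu_t\mathrm{Id}$, where $J_t$ is a linear operator as in the claim (the $O$ bound means $\|J_t-\nabla^2f(x_t)\|\le C\,r(x_t)^\theta$ with $C$ independent of $t$). Let $$q_t(x):=\langle g_t,x-x_t\rangle+\tfrac12\langle H_t(x-x_t),x-x_t\rangle+\Psi(x),\quad \hat r_t(x):=\left\|x-\operatorname{prox}_\Psi\big(x-g_t-H_t(x-x_t)\big)\right\| .$$ Find an approximate minimizer $\tilde x_{t+1}$ of $q_t$ satisfying $q_t(\tilde x_{t+1})\le q_t(x_t)$ and $\hat r_t(\tilde x_{t+1})\le\nu\min\{r(x_t)^{1+\rho},r(x_t)\}$. (2) Set $\tilde p_t:=\tilde x_{t+1}-x_t$; terminate if $\tilde p_t=0$. (3) For $\alpha>0$ let $y_{t+1}(\alpha):=x_t+\alpha\tilde p_t$ and $\bar x_{t+1}(\alpha):=\operatorname{prox}_{\Psi/L}\big(y_{t+1}(\alpha)-\tfrac1L\nabla f(y_{t+1}(\alpha))\big)$. Starting with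 $\alpha_t=1$, replace $\alpha_t$ by $\beta\alpha_t$ until $$F(\bar x_{t+1}(\alpha_t))\le F(x_t)-\gamma\alpha_t^2\|\tilde p_t\|^{2+\delta};$$ then set $x_{t+1}:=\bar x_{t+1}(\alpha_t)$.
   Formalization: Added assumption: at an iterate with r(x_t)=0 and nonzero step p̃_t, the backtracking loop in step (3) is assumed to end; otherwise (e.g. f=Ψ=0) the algorithm may neither terminate nor generate an infinite sequence. *)

theory Defs
  imports "HOL-Analysis.Analysis"
begin

text \<open>Convexity and closedness of an extended-real-valued function are those of its epigraph,
  which avoids sums of the form \<open>\<infinity> + (-\<infinity>)\<close>.\<close>

definition epi :: "('a \<Rightarrow> ereal) \<Rightarrow> ('a \<times> real) set" where
  "epi g = {(x, a). g x \<le> ereal a}"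

definition convex_fun :: "('a::real_vector \<Rightarrow> ereal) \<Rightarrow> bool" where
  "convex_fun g \<longleftrightarrow> convex (epi g)"

definition closed_fun :: "('a::topological_space \<Rightarrow> ereal) \<Rightarrow> bool" where
  "closed_fun g \<longleftrightarrow> closed (epi g)"

definition proper_fun :: "('a \<Rightarrow> ereal) \<Rightarrow> bool" where
  "proper_fun g \<longleftrightarrow> (\<forall>x. g x \<noteq> -\<infinity>) \<and> (\<exists>x. g x \<noteq> \<infinity>)"

definition prox :: "('a::real_inner \<Rightarrow> ereal) \<Rightarrow> 'a \<Rightarrow> 'a" where
  "prox g x = (THE y. is_arg_min (\<lambda>z. ereal (1/2 * (norm (z - x))\<^sup>2) + g z) (\<lambda>_. True) y)"

definition objective :: "('a \<Rightarrow> real) \<Rightarrow> ('a \<Rightarrow> ereal) \<Rightarrow> 'a \<Rightarrow> ereal" where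
  "objective f \<Psi> x = ereal (f x) + \<Psi> x"

text \<open>Below, \<open>gradf\<close> stands for the gradient of \<open>f\<close>.\<close>

definition residual :: "('a::real_inner \<Rightarrow> 'a) \<Rightarrow> ('a \<Rightarrow> ereal) \<Rightarrow> 'a \<Rightarrow> real" where
  "residual gradf \<Psi> x = norm (x - prox \<Psi> (x - gradf x))"

definition stationary_points :: "('a::real_inner \<Rightarrow> 'a) \<Rightarrow> ('a \<Rightarrow> ereal) \<Rightarrow> 'a set" where
  "stationary_points gradf \<Psi> = {x. residual gradf \<Psi> x = 0}"

text \<open>In the definitions of the algorithm, \<open>xt\<close> is the current iterate, \<open>J\<close> the approximate
  Hessian, \<open>H\<close> the regularized one, and \<open>p\<close> the search direction.\<close>

definition reg_hess ::
  "('a::real_inner \<Rightarrow> 'a) \<Rightarrow> ('a \<Rightarrow> ereal) \<Rightarrow> real \<Rightarrow> real \<Rightarrow> ('a \<Rightarrow>\<^sub>L 'a) \<Rightarrow> 'a \<Rightarrow> ('a \<Rightarrow>\<^sub>L 'a)" where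
  "reg_hess gradf \<Psi> c \<rho> J xt = J + (c * residual gradf \<Psi> xt powr \<rho>) *\<^sub>R id_blinfun"

definition model ::
  "('a::real_inner \<Rightarrow> 'a) \<Rightarrow> ('a \<Rightarrow> ereal) \<Rightarrow> ('a \<Rightarrow>\<^sub>L 'a) \<Rightarrow> 'a \<Rightarrow> 'a \<Rightarrow> ereal" where
  "model gradf \<Psi> H xt x =
     ereal (inner (gradf xt) (x - xt) + 1/2 * inner (blinfun_apply H (x - xt)) (x - xt)) + \<Psi> x"

definition model_residual ::
  "('a::real_inner \<Rightarrow> 'a) \<Rightarrow> ('a \<Rightarrow> ereal) \<Rightarrow> ('a \<Rightarrow>\<^sub>L 'a) \<Rightarrow> 'a \<Rightarrow> 'a \<Rightarrow> real" where
  "model_residual gradf \<Psi> H xt x =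
     norm (x - prox \<Psi> (x - gradf xt - blinfun_apply H (x - xt)))"

definition approx_minimizer ::
  "('a::real_inner \<Rightarrow> 'a) \<Rightarrow> ('a \<Rightarrow> ereal) \<Rightarrow> real \<Rightarrow> real \<Rightarrow> ('a \<Rightarrow>\<^sub>L 'a) \<Rightarrow> 'a \<Rightarrow> 'a \<Rightarrow> bool" where
  "approx_minimizer gradf \<Psi> \<nu> \<rho> H xt x \<longleftrightarrow>
     model gradf \<Psi> H xt x \<le> model gradf \<Psi> H xt xt \<and>
     model_residual gradf \<Psi> H xt x
       \<le> \<nu> * min (residual gradf \<Psi> xt powr (1 + \<rho>)) (residual gradf \<Psi> xt)"

definition trial_point ::
  "('a::real_inner \<Rightarrow> 'a) \<Rightarrow> ('a \<Rightarrow> ereal) \<Rightarrow> real \<Rightarrow> 'a \<Rightarrow> 'a \<Rightarrow> real \<Rightarrow> 'a" where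
  "trial_point gradf \<Psi> L xt p \<alpha> =
     (let y = xt + \<alpha> *\<^sub>R p in prox (\<lambda>z. \<Psi> z / ereal L) (y - (1/L) *\<^sub>R gradf y))"

definition sufficient_decrease ::
  "('a::real_inner \<Rightarrow> real) \<Rightarrow> ('a \<Rightarrow> 'a) \<Rightarrow> ('a \<Rightarrow> ereal) \<Rightarrow> real \<Rightarrow> real \<Rightarrow> real \<Rightarrow>
     'a \<Rightarrow> 'a \<Rightarrow> real \<Rightarrow> bool" where
  "sufficient_decrease f gradf \<Psi> L \<gamma> \<delta> xt p \<alpha> \<longleftrightarrow>
     objective f \<Psi> (trial_point gradf \<Psi> L xt p \<alpha>)
       \<le> objective f \<Psi> xt - ereal (\<gamma> * \<alpha>\<^sup>2 * norm p powr (2 + \<delta>))"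

definition line_search_halts ::
  "('a::real_inner \<Rightarrow> real) \<Rightarrow> ('a \<Rightarrow> 'a) \<Rightarrow> ('a \<Rightarrow> ereal) \<Rightarrow> real \<Rightarrow> real \<Rightarrow> real \<Rightarrow> real \<Rightarrow>
     'a \<Rightarrow> 'a \<Rightarrow> bool" where
  "line_search_halts f gradf \<Psi> L \<beta> \<gamma> \<delta> xt p \<longleftrightarrow>
     (\<exists>i::nat. sufficient_decrease f gradf \<Psi> L \<gamma> \<delta> xt p (\<beta> ^ i))"

text \<open>The step size found by the backtracking loop; meaningful only if the loop halts.\<close>

definition line_search_step ::
  "('a::real_inner \<Rightarrow> real) \<Rightarrow> ('a \<Rightarrow> 'a) \<Rightarrow> ('a \<Rightarrow> ereal) \<Rightarrow> real \<Rightarrow> real \<Rightarrow> real \<Rightarrow> real \<Rightarrow>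
     'a \<Rightarrow> 'a \<Rightarrow> real" where
  "line_search_step f gradf \<Psi> L \<beta> \<gamma> \<delta> xt p =
     \<beta> ^ (LEAST i::nat. sufficient_decrease f gradf \<Psi> L \<gamma> \<delta> xt p (\<beta> ^ i))"

text \<open>A run is given by sequences \<open>x\<close> (iterates) and \<open>xtil\<close> (approximate minimizers, with
  \<open>xtil (Suc t)\<close> computed in iteration \<open>t\<close>). Iteration \<open>t\<close> is reached if each earlier iteration
  neither terminated the algorithm (\<open>xtil (Suc s) = x s\<close>) nor got stuck in the backtracking loop.
  Entries belonging to iterations that are not reached carry no meaning.\<close>

definition reached ::
  "('a::real_inner \<Rightarrow> real) \<Rightarrow> ('a \<Rightarrow> 'a) \<Rightarrow> ('a \<Rightarrow> ereal) \<Rightarrow> real \<Rightarrow> real \<Rightarrow> real \<Rightarrow> real \<Rightarrow>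
     (nat \<Rightarrow> 'a) \<Rightarrow> (nat \<Rightarrow> 'a) \<Rightarrow> nat \<Rightarrow> bool" where
  "reached f gradf \<Psi> L \<beta> \<gamma> \<delta> x xtil t \<longleftrightarrow>
     (\<forall>s<t. xtil (Suc s) \<noteq> x s \<and>
            line_search_halts f gradf \<Psi> L \<beta> \<gamma> \<delta> (x s) (xtil (Suc s) - x s))"

text \<open>The rules of the algorithm, where \<open>J t\<close> is the operator used in iteration \<open>t\<close>.
  The last clause concerns only iterates with zero residual. There the regularization vanishes, a
  minimizer of the (then merely convex) model different from \<open>x t\<close> may be returned, and the
  backtracking loop need not end (e.g. \<open>f = 0\<close>, \<open>\<Psi> = 0\<close>); runs stuck in this way, which neither
  terminate nor generate an infinite sequence, are excluded. That the loop ends at every iterate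
  with nonzero residual is not part of the definition.\<close>

definition algorithm_run ::
  "('a::real_inner \<Rightarrow> real) \<Rightarrow> ('a \<Rightarrow> 'a) \<Rightarrow> ('a \<Rightarrow> ereal) \<Rightarrow>
     real \<Rightarrow> real \<Rightarrow> real \<Rightarrow> real \<Rightarrow> real \<Rightarrow> real \<Rightarrow> real \<Rightarrow>
     (nat \<Rightarrow> 'a \<Rightarrow>\<^sub>L 'a) \<Rightarrow> (nat \<Rightarrow> 'a) \<Rightarrow> (nat \<Rightarrow> 'a) \<Rightarrow> bool" where
  "algorithm_run f gradf \<Psi> L \<beta> \<gamma> \<nu> \<rho> c \<delta> J x xtil \<longleftrightarrow>
     (\<forall>t. reached f gradf \<Psi> L \<beta> \<gamma> \<delta> x xtil t \<longrightarrow>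
        approx_minimizer gradf \<Psi> \<nu> \<rho> (reg_hess gradf \<Psi> c \<rho> (J t) (x t)) (x t) (xtil (Suc t))) \<and>
     (\<forall>t. reached f gradf \<Psi> L \<beta> \<gamma> \<delta> x xtil (Suc t) \<longrightarrow>
        x (Suc t) = trial_point gradf \<Psi> L (x t) (xtil (Suc t) - x t)
          (line_search_step f gradf \<Psi> L \<beta> \<gamma> \<delta> (x t) (xtil (Suc t) - x t))) \<and>
     (\<forall>t. reached f gradf \<Psi> L \<beta> \<gamma> \<delta> x xtil t \<and> xtil (Suc t) \<noteq> x t \<and> residual gradf \<Psi> (x t) = 0 \<longrightarrow>
        line_search_halts f gradf \<Psi> L \<beta> \<gamma> \<delta> (x t) (xtil (Suc t) - x t))"

definition terminates_at :: 
  "('a::real_inner \<Rightarrow> real) \<Rightarrow> ('a \<Rightarrow> 'a) \<Rightarrow> ('a \<Rightarrow> ereal) \<Rightarrow> real \<Rightarrow> real \<Rightarrow> real \<Rightarrow> real \<Rightarrow>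
     (nat \<Rightarrow> 'a) \<Rightarrow> (nat \<Rightarrow> 'a) \<Rightarrow> nat \<Rightarrow> bool" where
  "terminates_at f gradf \<Psi> L \<beta> \<gamma> \<delta> x xtil t \<longleftrightarrow>
     reached f gradf \<Psi> L \<beta> \<gamma> \<delta> x xtil t \<and> xtil (Suc t) - x t = 0"

definition infinite_run ::
  "('a::real_inner \<Rightarrow> real) \<Rightarrow> ('a \<Rightarrow> 'a) \<Rightarrow> ('a \<Rightarrow> ereal) \<Rightarrow> real \<Rightarrow> real \<Rightarrow> real \<Rightarrow> real \<Rightarrow>
     (nat \<Rightarrow> 'a) \<Rightarrow> (nat \<Rightarrow> 'a) \<Rightarrow> bool" where
  "infinite_run f gradf \<Psi> L \<beta> \<gamma> \<delta> x xtil \<longleftrightarrow> (\<forall>t. reached f gradf \<Psi> L \<beta> \<gamma> \<delta> x xtil t)"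

definition accumulation_point :: "(nat \<Rightarrow> 'a::topological_space) \<Rightarrow> 'a \<Rightarrow> bool" where
  "accumulation_point x z \<longleftrightarrow> (\<exists>s::nat \<Rightarrow> nat. strict_mono s \<and> (x \<circ> s) \<longlonglongrightarrow> z)"

end

theory Submission
  imports Defs
begin

text \<open>Comparing the model at \<open>x\<^sub>t\<close> and at the trial minimizer shows, by the descent lemma and
  convexity of \<open>\<Psi>\<close>, that along \<open>p\<^sub>t\<close> the objective falls by at least
  \<open>\<alpha> (\<mu>\<^sub>t - \<alpha> L) \<parallel>p\<^sub>t\<parallel>\<^sup>2 / 2\<close>, and the extra proximal gradient step does not increase it. Hence
  every \<open>\<alpha> \<le> \<mu>\<^sub>t / (L + 2 \<gamma> \<parallel>p\<^sub>t\<parallel>\<^sup>\<delta>)\<close> with \<open>\<alpha> \<le> 1\<close> passes the line search. Nonexpansiveness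
  of \<open>prox\<close> gives \<open>(1 - \<nu>) r(x\<^sub>t) \<le> (2 + \<parallel>H\<^sub>t\<parallel>) \<parallel>p\<^sub>t\<parallel>\<close>. Together, \<open>r(x\<^sub>t) \<ge> \<epsilon>\<close> forces
  a decrease of \<open>F\<close> bounded away from zero, which can happen only finitely often.

  The objective may be infinite at \<open>x\<^sub>0\<close>; it is finite from \<open>x\<^sub>1\<close> on, because proximal points
  lie in the domain of \<open>\<Psi>\<close>.\<close>

section \<open>Convex functions and proximal points\<close>

text \<open>Working with real upper bounds \<open>a\<close> and \<open>b\<close> instead of function
  values keeps the arithmetic in the reals and spares case distinctions on infinite values.\<close>

lemma convex_fun_le:
  assumes "convex_fun g" "g x \<le> ereal a" "g y \<le> ereal b" "0 \<le> u" "u \<le> 1"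
  shows "g (x + u *\<^sub>R (y - x)) \<le> ereal (a + u * (b - a))"
proof -
  have "(1 - u) *\<^sub>R (x, a) + u *\<^sub>R (y, b) \<in> epi g"
    using assms unfolding convex_fun_def
    by (intro convexD_alt) (auto simp: epi_def)
  then show ?thesis
    by (simp add: epi_def algebra_simps)
qed

text \<open>Around a point of the domain closedness bounds \<open>g\<close> below, and convexity extends this to
  a bound of linear growth everywhere; this replaces the affine minorant from the Hahn-Banach
  theorem.\<close>

lemma convex_closed_lower_bound:
  fixes g :: "'a::real_inner \<Rightarrow> ereal"
  assumes "convex_fun g" "closed_fun g" "proper_fun g"
  obtains A B z0 where "B \<ge> 0" "\<And>z a. g z \<le> ereal a \<Longrightarrow> A - B * norm (z - z0) \<le> a"
proof -
  obtain z0 where "g z0 \<noteq> \<infinity>" "g z0 \<noteq> -\<infinity>"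
    using assms(3) by (auto simp: proper_fun_def)
  then obtain b where b: "g z0 = ereal b"
    by (cases "g z0") auto
  have "open (- epi g)" "(z0, b - 1) \<in> - epi g"
    using assms(2) b by (auto simp: closed_fun_def epi_def)
  then obtain e where e: "e > 0" "\<And>q. dist q (z0, b - 1) < e \<Longrightarrow> q \<notin> epi g"
    unfolding open_dist by blast
  define d where "d = e / 2"
  have d: "d > 0" "d < e"
    using e(1) by (auto simp: d_def)
  \<comment> \<open>Epigraphs are closed upwards, so a bound \<open>a \<le> b - 1\<close> would put
    \<open>(z, b - 1)\<close> into the epigraph, too close to \<open>(z0, b - 1)\<close>.\<close>
  have near: "b - 1 < a" if "g z \<le> ereal a" "norm (z - z0) \<le> d" for z a
  proof (rule ccontr)
    assume "\<not> b - 1 < a"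
    then have "(z, b - 1) \<in> epi g"
      using order_trans[OF that(1)] by (simp add: epi_def)
    moreover have "dist (z, b - 1) (z0, b - 1) < e"
      using that(2) d by (simp add: dist_Pair_Pair dist_norm)
    ultimately show False
      using e(2) by blast
  qed
  have "b - 1 - (1 / d) * norm (z - z0) \<le> a" if a: "g z \<le> ereal a" for z a
  proof (cases "norm (z - z0) \<le> d")
    case True
    moreover have "0 \<le> (1 / d) * norm (z - z0)"
      using d by simp
    ultimately show ?thesis
      using near[OF a] by linarith
  next
    case False
    \<comment> \<open>The factor \<open>u\<close> pulls \<open>z\<close> back to distance
      \<open>d\<close> from \<open>z0\<close>, where \<open>near\<close> applies; comparing with the
      convexity bound there gives a lower bound on \<open>a\<close>.\<close>
    define s u where "s = norm (z - z0)" and "u = d / s"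
    have s: "s > d" "s > 0"
      using False d by (auto simp: s_def)
    then have u: "0 < u" "u \<le> 1"
      using d by (auto simp: u_def)
    have "g (z0 + u *\<^sub>R (z - z0)) \<le> ereal (b + u * (a - b))"
      using assms(1) a b u by (intro convex_fun_le) auto
    moreover have "norm (z0 + u *\<^sub>R (z - z0) - z0) \<le> d"
      using u s d by (simp add: s_def[symmetric]) (simp add: u_def)
    ultimately have "b - 1 < b + u * (a - b)"
      by (rule near)
    then have "- 1 < d * (a - b) / s"
      by (simp add: u_def)
    then have "- s < d * (a - b)"
      using s by (simp add: field_simps)
    then have "- (s / d) < a - b"
      using d by (simp add: field_simps)
    then show ?thesis
      by (simp add: s_def)
  qed
  then show ?thesis
    using d that[of "1 / d" "b - 1" z0] by simp
qed

text \<open>A minimizing sequence is Cauchy by the parallelogram identity.\<close>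

lemma prox_minimizer_exists:
  fixes g :: "'a::{real_inner, complete_space} \<Rightarrow> ereal"
  assumes "convex_fun g" "closed_fun g" "proper_fun g"
  obtains y b where "g y = ereal b"
    "\<And>z a. g z \<le> ereal a \<Longrightarrow> (norm (y - x))\<^sup>2 / 2 + b \<le> (norm (z - x))\<^sup>2 / 2 + a"
proof -
  obtain A B z0 where B: "B \<ge> 0"
    and AB: "\<And>z a. g z \<le> ereal a \<Longrightarrow> A - B * norm (z - z0) \<le> a"
    by (rule convex_closed_lower_bound[OF assms], rule that)
  \<comment> \<open>The proximal objective lifted to the epigraph: it is real-valued, and the set it
    is minimized over is closed.\<close>
  define val where "val = (\<lambda>(z, a). (norm (z - x))\<^sup>2 / 2 + a)"
  define m where "m = (INF q\<in>epi g. val q)"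
  have ne: "epi g \<noteq> {}"
  proof -
    obtain z where "g z \<noteq> \<infinity>" "g z \<noteq> -\<infinity>"
      using assms(3) by (auto simp: proper_fun_def)
    then have "(z, real_of_ereal (g z)) \<in> epi g"
      by (cases "g z") (auto simp: epi_def)
    then show ?thesis by blast
  qed
  \<comment> \<open>The quadratic term beats the linear loss: \<open>s^2 / 2 - B * s\<close> is at
    least \<open>- B^2 / 2\<close> for \<open>s = norm (z - x)\<close>.\<close>
  have "A - B * norm (x - z0) - B\<^sup>2 / 2 \<le> val q" if q_epi: "q \<in> epi g" for q
  proof -
    obtain z a where q: "q = (z, a)" and "g z \<le> ereal a"
      using q_epi by (cases q) (auto simp: epi_def)
    then have "A - B * norm (z - z0) \<le> a"
      using AB by blast
    moreover have "B * norm (z - z0) \<le> B * (norm (z - x) + norm (x - z0))"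
      using B norm_triangle_ineq[of "z - x" "x - z0"] by (intro mult_left_mono) auto
    moreover have "0 \<le> (norm (z - x) - B)\<^sup>2"
      by simp
    ultimately show ?thesis
      by (simp add: q val_def power2_diff algebra_simps)
  qed
  then have bdd: "bdd_below (val ` epi g)"
    by (meson bdd_belowI2)
  have m_le: "m \<le> val q" if "q \<in> epi g" for q
    unfolding m_def using bdd that by (rule cINF_lower)
  have "\<exists>q\<in>epi g. val q < m + 1 / Suc n" for n
    unfolding m_def using ne bdd
    by (intro cINF_less_iff[THEN iffD1]) auto
  then obtain q where q: "\<And>n. q n \<in> epi g" "\<And>n. val (q n) < m + 1 / Suc n"
    by metis
  define z a where "z = fst \<circ> q" and "a = snd \<circ> q"
  have qza: "q n = (z n, a n)" for n
    by (simp add: z_def a_def)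
  have gap: "(norm (z i - z j))\<^sup>2 \<le> 4 * (1 / Suc i + 1 / Suc j)" for i j
  proof -
    have "(1 - 1/2) *\<^sub>R q i + (1/2) *\<^sub>R q j \<in> epi g"
      using assms(1) q(1) unfolding convex_fun_def by (intro convexD_alt) auto
    from m_le[OF this]
    have "m \<le> (norm ((1/2) *\<^sub>R z i + (1/2) *\<^sub>R z j - x))\<^sup>2 / 2 + (a i / 2 + a j / 2)"
      by (simp add: qza val_def)
    also have "(norm ((1/2) *\<^sub>R z i + (1/2) *\<^sub>R z j - x))\<^sup>2
        = ((norm (z i - x))\<^sup>2 + (norm (z j - x))\<^sup>2) / 2 - (norm (z i - z j))\<^sup>2 / 4"
      by (simp add: power2_norm_eq_inner inner_diff inner_add inner_commute algebra_simps
          add_divide_distrib diff_divide_distrib)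
    finally have "(norm (z i - z j))\<^sup>2 / 8 \<le> (val (q i) + val (q j)) / 2 - m"
      by (simp add: qza val_def field_simps)
    also have "\<dots> \<le> (1 / Suc i + 1 / Suc j) / 2"
      using q(2)[of i] q(2)[of j] by argo
    finally show ?thesis
      by argo
  qed
  have "Cauchy z"
  proof (rule metric_CauchyI)
    fix e :: real assume "e > 0"
    then obtain N where N: "inverse (real (Suc N)) < e\<^sup>2 / 8"
      using reals_Archimedean[of "e\<^sup>2 / 8"] by auto
    have "dist (z i) (z j) < e" if "i \<ge> N" "j \<ge> N" for i j
    proof -
      have "1 / real (Suc k) \<le> inverse (real (Suc N))" if "k \<ge> N" for k
        using that by (simp add: field_simps)
      from gap[of i j] this[OF that(1)] this[OF that(2)] N have "(norm (z i - z j))\<^sup>2 < e\<^sup>2"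
        by argo
      then show ?thesis
        using \<open>e > 0\<close> by (simp add: dist_norm power2_less_imp_less)
    qed
    then show "\<exists>M. \<forall>i\<ge>M. \<forall>j\<ge>M. dist (z i) (z j) < e" by blast
  qed
  then obtain y where y: "z \<longlonglongrightarrow> y"
    using Cauchy_convergent convergent_def by blast
  \<comment> \<open>So far only the points \<open>z n\<close> are known to converge. Convergence of
    \<open>val\<close> makes the heights \<open>a n\<close> converge as well, and then closedness of
    the epigraph applies to the limit of \<open>q\<close>.\<close>
  have "(\<lambda>n. val (q n)) \<longlonglongrightarrow> m"
  proof (rule tendsto_sandwich[of "\<lambda>_. m" _ _ "\<lambda>n. m + 1 / Suc n"])
    show "(\<lambda>n. m + 1 / Suc n) \<longlonglongrightarrow> m"
      using tendsto_add[OF tendsto_const[of m] LIMSEQ_inverse_real_of_nat]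
      by (simp add: inverse_eq_divide)
  qed (use q m_le in \<open>auto intro!: always_eventually less_imp_le\<close>)
  then have "(\<lambda>n. val (q n) - (norm (z n - x))\<^sup>2 / 2) \<longlonglongrightarrow> m - (norm (y - x))\<^sup>2 / 2"
    by (intro tendsto_intros y) auto
  then have "a \<longlonglongrightarrow> m - (norm (y - x))\<^sup>2 / 2"
    by (simp add: qza val_def)
  then have "q \<longlonglongrightarrow> (y, m - (norm (y - x))\<^sup>2 / 2)"
    unfolding qza[abs_def] by (intro tendsto_Pair y)
  then have "(y, m - (norm (y - x))\<^sup>2 / 2) \<in> epi g"
    using assms(2) q(1) unfolding closed_fun_def by (meson closed_sequentially)
  then have le: "g y \<le> ereal (m - (norm (y - x))\<^sup>2 / 2)"
    by (simp add: epi_def)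
  moreover have "g y \<noteq> -\<infinity>"
    using assms(3) by (simp add: proper_fun_def)
  ultimately obtain b where b: "g y = ereal b"
    by (cases "g y") auto
  show ?thesis
  proof (rule that[OF b])
    fix w s assume "g w \<le> ereal s"
    then have "m \<le> val (w, s)"
      by (intro m_le) (simp add: epi_def)
    then show "(norm (y - x))\<^sup>2 / 2 + b \<le> (norm (w - x))\<^sup>2 / 2 + s"
      using le b by (simp add: val_def)
  qed
qed

text \<open>First-order optimality: \<open>x - y\<close> is a subgradient of \<open>g\<close> at
  \<open>y\<close>. Compare \<open>y\<close> with a point a fraction \<open>u\<close> of the way to
  \<open>z\<close>, divide by \<open>u\<close>, and let the quadratic term become small.\<close>

lemma prox_minimizer_variational:
  fixes g :: "'a::real_inner \<Rightarrow> ereal"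
  assumes g: "convex_fun g" and b: "g y = ereal b"
    and min: "\<And>z a. g z \<le> ereal a \<Longrightarrow> (norm (y - x))\<^sup>2 / 2 + b \<le> (norm (z - x))\<^sup>2 / 2 + a"
    and a: "g z \<le> ereal a"
  shows "b + inner (x - y) (z - y) \<le> a"
proof (rule field_le_epsilon)
  fix e :: real assume "e > 0"
  \<comment> \<open>The summand 1 keeps the denominator of \<open>e / n\<close> positive even for
    \<open>z = y\<close>; \<open>u\<close> is then small enough that the quadratic term costs at
    most \<open>e\<close>.\<close>
  define n where "n = (norm (z - y))\<^sup>2 + 1"
  define u where "u = min 1 (e / n)"
  have n: "n > 0"
    unfolding n_def by (intro add_nonneg_pos) auto
  have u: "0 < u" "u \<le> 1" "u * n \<le> e"
    using n \<open>e > 0\<close> by (auto simp: u_def min_def field_simps)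
  have "g (y + u *\<^sub>R (z - y)) \<le> ereal (b + u * (a - b))"
    using u b a by (intro convex_fun_le[OF g]) auto
  from min[OF this]
  have "(norm (y - x))\<^sup>2 \<le> (norm (y + u *\<^sub>R (z - y) - x))\<^sup>2 + 2 * (u * (a - b))"
    by simp
  also have "y + u *\<^sub>R (z - y) - x = u *\<^sub>R (z - y) - (x - y)"
    by simp
  also have "(norm (u *\<^sub>R (z - y) - (x - y)))\<^sup>2
      = u * (u * (norm (z - y))\<^sup>2) + (norm (y - x))\<^sup>2 - 2 * u * inner (x - y) (z - y)"
    unfolding norm_minus_commute[of y x] power2_norm_eq_inner inner_diff_left[of "u *\<^sub>R (z - y)"]
      inner_diff_right[of _ "u *\<^sub>R (z - y)"] inner_scaleR_left inner_scaleR_right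
      inner_commute[of "z - y" "x - y"]
    by (simp add: algebra_simps)
  finally have "0 \<le> u * (u * (norm (z - y))\<^sup>2 - 2 * inner (x - y) (z - y) + 2 * (a - b))"
    by (simp add: algebra_simps)
  then have "0 \<le> u * (norm (z - y))\<^sup>2 - 2 * inner (x - y) (z - y) + 2 * (a - b)"
    using u(1) by (simp add: zero_le_mult_iff)
  moreover have "u * (norm (z - y))\<^sup>2 \<le> e"
    using u by (simp add: n_def algebra_simps)
  ultimately show "b + inner (x - y) (z - y) \<le> a + e"
    using \<open>e > 0\<close> by argo
qed

text \<open>The definite description in \<open>prox\<close> is justified by uniqueness: testing the
  variational inequality at \<open>y\<close> with another minimizer \<open>z\<close> gives
  \<open>(norm (z - y))^2 \<le> 0\<close>. The value \<open>b\<close> is real, so proximal points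
  lie in the domain of \<open>g\<close>.\<close>

lemma prox_properties:
  fixes g :: "'a::{real_inner, complete_space} \<Rightarrow> ereal"
  assumes g: "convex_fun g" "closed_fun g" "proper_fun g"
  obtains b where "g (prox g x) = ereal b"
    "\<And>z a. g z \<le> ereal a \<Longrightarrow>
       (norm (prox g x - x))\<^sup>2 / 2 + b \<le> (norm (z - x))\<^sup>2 / 2 + a"
    "\<And>z a. g z \<le> ereal a \<Longrightarrow> b + inner (x - prox g x) (z - prox g x) \<le> a"
proof -
  obtain y b where b: "g y = ereal b"
    and min: "\<And>z a. g z \<le> ereal a \<Longrightarrow> (norm (y - x))\<^sup>2 / 2 + b \<le> (norm (z - x))\<^sup>2 / 2 + a"
    by (rule prox_minimizer_exists[OF g, of x], rule that)
  have vi: "b + inner (x - y) (z - y) \<le> a" if "g z \<le> ereal a" for z a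
    using g(1) b min that by (rule prox_minimizer_variational)
  let ?h = "\<lambda>z. ereal (1/2 * (norm (z - x))\<^sup>2) + g z"
  have eq: "prox g x = y"
    unfolding prox_def
  proof (rule the_equality)
    have "?h y \<le> ?h z" for z
    proof (cases "g z")
      case (real a)
      then show ?thesis
        using min[of z a] b by simp
    qed (use g(3) in \<open>auto simp: proper_fun_def\<close>)
    then show "is_arg_min ?h (\<lambda>_. True) y"
      by (simp add: is_arg_min_def not_less)
  next
    fix z assume "is_arg_min ?h (\<lambda>_. True) z"
    then have "?h z \<le> ?h y"
      by (simp add: is_arg_min_def not_less)
    moreover have "g z \<noteq> -\<infinity>"
      using g(3) by (simp add: proper_fun_def)
    ultimately obtain a where a: "g z = ereal a"
      and le: "(norm (z - x))\<^sup>2 / 2 + a \<le> (norm (y - x))\<^sup>2 / 2 + b"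
      using b by (cases "g z") auto
    have "(norm (z - x))\<^sup>2 = (norm (z - y))\<^sup>2 + (norm (y - x))\<^sup>2 - 2 * inner (x - y) (z - y)"
      by (simp add: power2_norm_eq_inner inner_diff inner_commute algebra_simps)
    moreover have "b + inner (x - y) (z - y) \<le> a"
      using a by (intro vi) simp
    ultimately have "(norm (z - y))\<^sup>2 \<le> 0"
      using le by argo
    then show "z = y" by simp
  qed
  show ?thesis
    by (rule that[unfolded eq]) (rule b, erule min, erule vi)
qed

text \<open>Test the variational inequality of each proximal point with the other one. In the sum
  the values of \<open>g\<close> cancel, which leaves firm nonexpansiveness; Cauchy-Schwarz
  finishes.\<close>

lemma prox_nonexpansive:
  fixes g :: "'a::{real_inner, complete_space} \<Rightarrow> ereal"
  assumes "convex_fun g" "closed_fun g" "proper_fun g"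
  shows "norm (prox g x - prox g y) \<le> norm (x - y)"
proof -
  let ?p = "prox g x" and ?q = "prox g y"
  obtain a where a: "g ?p = ereal a"
    "\<And>z s. g z \<le> ereal s \<Longrightarrow> a + inner (x - ?p) (z - ?p) \<le> s"
    using prox_properties[OF assms, of x] by metis
  obtain b where b: "g ?q = ereal b"
    "\<And>z s. g z \<le> ereal s \<Longrightarrow> b + inner (y - ?q) (z - ?q) \<le> s"
    using prox_properties[OF assms, of y] by metis
  have "a + inner (x - ?p) (?q - ?p) \<le> b" "b + inner (y - ?q) (?p - ?q) \<le> a"
    using a b by auto
  then have "(norm (?p - ?q))\<^sup>2 \<le> inner (x - y) (?p - ?q)"
    by (simp add: power2_norm_eq_inner inner_diff inner_commute algebra_simps)
  also have "\<dots> \<le> norm (x - y) * norm (?p - ?q)"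
    by (rule norm_cauchy_schwarz)
  finally show ?thesis
    by (cases "norm (?p - ?q) = 0") (auto simp: power2_eq_square)
qed

section \<open>Consequences of the Lipschitz gradient\<close>

lemma descent_lemma:
  assumes grad: "\<And>z. GDERIV f z :> gradf z" and lip: "L-lipschitz_on UNIV gradf"
  shows "f (y + d) \<le> f y + inner (gradf y) d + L / 2 * (norm d)\<^sup>2"
proof -
  \<comment> \<open>The gap between the two sides along the segment. By the Lipschitz bound its
    derivative is nonpositive, so monotonicity replaces integration.\<close>
  define \<phi> where "\<phi> = (\<lambda>t. f (y + t *\<^sub>R d) - t * inner (gradf y) d - L / 2 * t\<^sup>2 * (norm d)\<^sup>2)"
  have "\<phi> 1 \<le> \<phi> 0"
  proof (rule DERIV_nonpos_imp_nonincreasing[of 0 1])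
    fix t :: real assume t: "0 \<le> t" "t \<le> 1"
    let ?D = "inner (gradf (y + t *\<^sub>R d) - gradf y) d - L * t * (norm d)\<^sup>2"
    have "(f has_derivative (\<lambda>h. inner h (gradf (y + t *\<^sub>R d)))) (at (y + t *\<^sub>R d))"
      using grad by (simp add: gderiv_def)
    moreover have "((\<lambda>t. y + t *\<^sub>R d) has_derivative (\<lambda>h. h *\<^sub>R d)) (at t)"
      by (auto intro!: derivative_eq_intros)
    ultimately have "((\<lambda>t. f (y + t *\<^sub>R d)) has_derivative (\<lambda>h. inner (h *\<^sub>R d) (gradf (y + t *\<^sub>R d)))) (at t)"
      by (rule has_derivative_compose[rotated])
    then have "((\<lambda>t. f (y + t *\<^sub>R d)) has_real_derivative inner (gradf (y + t *\<^sub>R d)) d) (at t)"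
      by (simp add: has_field_derivative_def inner_commute mult_commute_abs)
    then have "(\<phi> has_real_derivative ?D) (at t)"
      unfolding \<phi>_def
      by (auto intro!: derivative_eq_intros simp: inner_diff_left)
    moreover have "?D \<le> 0"
    proof -
      have "inner (gradf (y + t *\<^sub>R d) - gradf y) d \<le> norm (gradf (y + t *\<^sub>R d) - gradf y) * norm d"
        by (rule norm_cauchy_schwarz)
      also have "\<dots> \<le> (L * norm (t *\<^sub>R d)) * norm d"
        using lipschitz_onD[OF lip, of "y + t *\<^sub>R d" y]
        by (intro mult_right_mono) (auto simp: dist_norm)
      also have "\<dots> = L * t * (norm d)\<^sup>2"
        using t by (simp add: power2_eq_square)
      finally show ?thesis by simp
    qed
    ultimately show "\<exists>D. (\<phi> has_real_derivative D) (at t) \<and> D \<le> 0" by blast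
  qed simp
  then show ?thesis
    by (simp add: \<phi>_def)
qed

text \<open>Difference quotients of \<open>h\<close> are bounded by \<open>L\<close>, hence so is
  their limit in every direction. Applied to the gradient, this bounds the Hessian
  uniformly.\<close>

lemma lipschitz_derivative_norm_le:
  fixes h :: "'a::real_normed_vector \<Rightarrow> 'b::real_normed_vector"
  assumes deriv: "(h has_derivative blinfun_apply D) (at z)" and lip: "L-lipschitz_on UNIV h"
  shows "norm D \<le> L"
proof (rule norm_blinfun_bound)
  show "0 \<le> L"
    using lip by (rule lipschitz_on_nonneg)
  fix v
  show "norm (blinfun_apply D v) \<le> L * norm v"
  proof (cases "v = 0")
    case False
    have "norm (blinfun_apply D v) / norm v \<le> L + e" if "e > 0" for e
    proof -
      obtain d where d: "d > 0" "\<And>y. 0 < norm (y - z) \<Longrightarrow> norm (y - z) < d \<Longrightarrow>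
          norm (h y - h z - blinfun_apply D (y - z)) / norm (y - z) < e"
        using deriv \<open>e > 0\<close> unfolding has_derivative_at' by metis
      define t where "t = d / (2 * norm v)"
      have t: "t > 0" "norm (t *\<^sub>R v) = d / 2"
        using d(1) False by (auto simp: t_def)
      have "norm (h (z + t *\<^sub>R v) - h z - blinfun_apply D (t *\<^sub>R v)) < e * norm (t *\<^sub>R v)"
        using d(2)[of "z + t *\<^sub>R v"] t d(1) by (simp add: field_simps)
      moreover have "norm (h (z + t *\<^sub>R v) - h z) \<le> L * norm (t *\<^sub>R v)"
        using lipschitz_onD[OF lip, of "z + t *\<^sub>R v" z] by (simp add: dist_norm)
      moreover have "norm (blinfun_apply D (t *\<^sub>R v)) \<le> norm (h (z + t *\<^sub>R v) - h z)
          + norm (h (z + t *\<^sub>R v) - h z - blinfun_apply D (t *\<^sub>R v))"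
        by (metis norm_triangle_sub norm_minus_commute)
      ultimately have "t * norm (blinfun_apply D v) \<le> t * ((L + e) * norm v)"
        using t(1) by (simp add: blinfun.scaleR_right algebra_simps)
      then have "norm (blinfun_apply D v) \<le> (L + e) * norm v"
        using t(1) by (rule mult_left_le_imp_le)
      then show ?thesis
        using False by (simp add: divide_le_eq)
    qed
    then have "norm (blinfun_apply D v) / norm v \<le> L"
      by (rule field_le_epsilon)
    then show ?thesis
      using False by (simp add: field_simps)
  qed simp
qed

text \<open>The epigraph of the scaled function is the preimage of \<open>epi g\<close> under a
  continuous linear map. This makes the facts on \<open>prox\<close> available for the step of
  length \<open>1 / L\<close>.\<close>

lemma scaled_closed_convex_proper:
  fixes g :: "'a::real_inner \<Rightarrow> ereal"
  assumes "L > 0" and g: "convex_fun g" "closed_fun g" "proper_fun g"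
  shows "convex_fun (\<lambda>z. g z / ereal L)" "closed_fun (\<lambda>z. g z / ereal L)"
    "proper_fun (\<lambda>z. g z / ereal L)"
proof -
  have le: "g z / ereal L \<le> ereal a \<longleftrightarrow> g z \<le> ereal (L * a)" for z a
    using \<open>L > 0\<close> by (cases "g z") (auto simp: field_simps)
  have epi: "epi (\<lambda>z. g z / ereal L) = (\<lambda>q. (fst q, L * snd q)) -` epi g"
    by (auto simp: epi_def le)
  have "linear (\<lambda>q::'a \<times> real. (fst q, L * snd q))"
    by (rule linearI) (auto simp: algebra_simps)
  then show "convex_fun (\<lambda>z. g z / ereal L)"
    using g(1) unfolding convex_fun_def epi by (rule convex_linear_vimage)
  show "closed_fun (\<lambda>z. g z / ereal L)"
    using g(2) unfolding closed_fun_def epi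
    by (intro closed_vimage continuous_intros)
  have "g z / ereal L = \<infinity> \<longleftrightarrow> g z = \<infinity>" "g z / ereal L = -\<infinity> \<longleftrightarrow> g z = -\<infinity>" for z
    using \<open>L > 0\<close> by (cases "g z"; simp)+
  then show "proper_fun (\<lambda>z. g z / ereal L)"
    using g(3) by (simp add: proper_fun_def)
qed

section \<open>Decrease of the objective along a search direction\<close>

text \<open>Up to scaling and a constant, the proximal gradient step from
  \<open>y = x + \<alpha> *\<^sub>R p\<close> minimizes the quadratic upper model of the objective
  at \<open>y\<close>. By the descent lemma this model majorizes the objective, and both agree at
  \<open>y\<close>.\<close>

lemma trial_point_properties:
  fixes f :: "'a::{real_inner, complete_space} \<Rightarrow> real"
  assumes grad: "\<And>z. GDERIV f z :> gradf z" and lip: "L-lipschitz_on UNIV gradf" and "L > 0"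
    and \<Psi>: "convex_fun \<Psi>" "closed_fun \<Psi>" "proper_fun \<Psi>"
  shows "\<Psi> (trial_point gradf \<Psi> L x p \<alpha>) \<noteq> \<infinity>"
    and "objective f \<Psi> (trial_point gradf \<Psi> L x p \<alpha>) \<le> objective f \<Psi> (x + \<alpha> *\<^sub>R p)"
proof -
  define y w where "y = x + \<alpha> *\<^sub>R p" and "w = trial_point gradf \<Psi> L x p \<alpha>"
  let ?v = "y - (1 / L) *\<^sub>R gradf y"
  have w: "w = prox (\<lambda>z. \<Psi> z / ereal L) ?v"
    by (simp add: w_def y_def trial_point_def Let_def)
  obtain b where b: "\<Psi> w / ereal L = ereal b"
    and min: "\<And>z a. \<Psi> z / ereal L \<le> ereal a \<Longrightarrow>
       (norm (w - ?v))\<^sup>2 / 2 + b \<le> (norm (z - ?v))\<^sup>2 / 2 + a"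
    using prox_properties[OF scaled_closed_convex_proper[OF \<open>L > 0\<close> \<Psi>], of ?v] w by metis
  have \<Psi>w: "\<Psi> w = ereal (L * b)"
    using b \<open>L > 0\<close> by (cases "\<Psi> w") (auto simp: field_simps)
  then show "\<Psi> (trial_point gradf \<Psi> L x p \<alpha>) \<noteq> \<infinity>"
    by (simp add: w_def)
  have "objective f \<Psi> w \<le> objective f \<Psi> y"
  proof (cases "\<Psi> y")
    case (real a)
    have "(norm (w - ?v))\<^sup>2 / 2 + b \<le> (norm (y - ?v))\<^sup>2 / 2 + a / L"
      using real \<open>L > 0\<close> by (intro min) simp
    moreover have "(norm (w - ?v))\<^sup>2
        = (norm (w - y))\<^sup>2 + 2 * (inner (gradf y) (w - y) / L) + (norm (y - ?v))\<^sup>2"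
      unfolding power2_norm_eq_inner
      by (simp del: norm_scaleR add: power2_norm_eq_inner inner_diff inner_commute algebra_simps
            diff_divide_distrib)
    ultimately have "(norm (w - y))\<^sup>2 / 2 + inner (gradf y) (w - y) / L + b \<le> a / L"
      by argo
    then have "L * ((norm (w - y))\<^sup>2 / 2 + inner (gradf y) (w - y) / L + b) \<le> L * (a / L)"
      using \<open>L > 0\<close> by (intro mult_left_mono) auto
    moreover have "L * (s / 2 + i / L + b) = L / 2 * s + i + L * b" for s i
      using \<open>L > 0\<close> by (simp add: distrib_left)
    ultimately have "L / 2 * (norm (w - y))\<^sup>2 + inner (gradf y) (w - y) + L * b \<le> a"
      using \<open>L > 0\<close> by simp
    moreover have "f w \<le> f y + inner (gradf y) (w - y) + L / 2 * (norm (w - y))\<^sup>2"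
      using descent_lemma[OF grad lip, of y "w - y"] by simp
    ultimately show ?thesis
      by (simp add: objective_def real \<Psi>w)
  qed (use \<Psi>(3) in \<open>auto simp: objective_def proper_fun_def\<close>)
  then show "objective f \<Psi> (trial_point gradf \<Psi> L x p \<alpha>) \<le> objective f \<Psi> (x + \<alpha> *\<^sub>R p)"
    by (simp add: w_def y_def)
qed

text \<open>The model comparison bounds the change of linear term plus \<open>\<Psi>\<close> over
  the full step by \<open>- \<mu> / 2 * (norm p)^2\<close>. Convexity scales this by
  \<open>\<alpha>\<close>; the descent lemma adds an error quadratic in
  \<open>\<alpha>\<close>.\<close>

lemma model_descent_step:
  assumes grad: "\<And>z. GDERIV f z :> gradf z" and lip: "L-lipschitz_on UNIV gradf"
    and \<Psi>: "convex_fun \<Psi>" "proper_fun \<Psi>"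
    and fin: "\<Psi> x = ereal a"
    and model: "model gradf \<Psi> H x (x + p) \<le> model gradf \<Psi> H x x"
    and H: "\<mu> * (norm p)\<^sup>2 \<le> inner (blinfun_apply H p) p"
    and \<alpha>: "0 \<le> \<alpha>" "\<alpha> \<le> 1"
  shows "objective f \<Psi> (x + \<alpha> *\<^sub>R p)
    \<le> ereal (f x + a - \<alpha> * (\<mu> - \<alpha> * L) / 2 * (norm p)\<^sup>2)"
proof -
  have "\<Psi> (x + p) \<noteq> -\<infinity>"
    using \<Psi>(2) by (simp add: proper_fun_def)
  then obtain b where b: "\<Psi> (x + p) = ereal b"
    and q: "inner (gradf x) p + inner (blinfun_apply H p) p / 2 + b \<le> a"
    using model fin by (cases "\<Psi> (x + p)") (auto simp: model_def)
  have "\<Psi> (x + \<alpha> *\<^sub>R p) \<le> ereal (a + \<alpha> * (b - a))"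
    using convex_fun_le[OF \<Psi>(1), of x a "x + p" b \<alpha>] fin b \<alpha> by simp
  moreover have "f (x + \<alpha> *\<^sub>R p) \<le> f x + \<alpha> * inner (gradf x) p + L / 2 * (\<alpha>\<^sup>2 * (norm p)\<^sup>2)"
    using descent_lemma[OF grad lip, of x "\<alpha> *\<^sub>R p"] by (simp add: power_mult_distrib)
  ultimately have "objective f \<Psi> (x + \<alpha> *\<^sub>R p)
      \<le> ereal (f x + \<alpha> * inner (gradf x) p + L / 2 * (\<alpha>\<^sup>2 * (norm p)\<^sup>2)) + ereal (a + \<alpha> * (b - a))"
    unfolding objective_def by (intro add_mono) auto
  also have "\<dots> \<le> ereal (f x + a - \<alpha> * (\<mu> - \<alpha> * L) / 2 * (norm p)\<^sup>2)"
  proof -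
    have "inner (gradf x) p + b - a \<le> - (\<mu> / 2 * (norm p)\<^sup>2)"
      using q H by simp
    then have "\<alpha> * (inner (gradf x) p + b - a) \<le> \<alpha> * - (\<mu> / 2 * (norm p)\<^sup>2)"
      using \<alpha>(1) by (rule mult_left_mono)
    then show ?thesis
      by (simp add: algebra_simps power2_eq_square add_divide_distrib diff_divide_distrib)
  qed
  finally show ?thesis .
qed

text \<open>The last bound on \<open>\<alpha>\<close>, multiplied by
  \<open>\<alpha> * (norm p)^2 / 2\<close>, says that the decrease from
  \<open>model_descent_step\<close> covers the one demanded by the line search.\<close>

lemma sufficient_decreaseI:
  fixes f :: "'a::{real_inner, complete_space} \<Rightarrow> real"
  assumes grad: "\<And>z. GDERIV f z :> gradf z" and lip: "L-lipschitz_on UNIV gradf" and "L > 0"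
    and \<Psi>: "convex_fun \<Psi>" "closed_fun \<Psi>" "proper_fun \<Psi>"
    and model: "model gradf \<Psi> H x (x + p) \<le> model gradf \<Psi> H x x"
    and H: "\<mu> * (norm p)\<^sup>2 \<le> inner (blinfun_apply H p) p"
    and \<alpha>: "0 \<le> \<alpha>" "\<alpha> \<le> 1" "\<alpha> * (L + 2 * \<gamma> * norm p powr \<delta>) \<le> \<mu>"
  shows "sufficient_decrease f gradf \<Psi> L \<gamma> \<delta> x p \<alpha>"
proof (cases "\<Psi> x")
  case (real a)
  have "norm p powr (2 + \<delta>) = norm p powr \<delta> * (norm p)\<^sup>2"
    by (simp add: powr_add)
  moreover have "\<alpha> * (norm p)\<^sup>2 * (\<alpha> * (L + 2 * \<gamma> * norm p powr \<delta>)) \<le> \<alpha> * (norm p)\<^sup>2 * \<mu>"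
    using \<alpha> by (intro mult_left_mono) auto
  ultimately have "\<gamma> * \<alpha>\<^sup>2 * norm p powr (2 + \<delta>) \<le> \<alpha> * (\<mu> - \<alpha> * L) / 2 * (norm p)\<^sup>2"
    by (simp add: field_simps power2_eq_square)
  then have "ereal (f x + a - \<alpha> * (\<mu> - \<alpha> * L) / 2 * (norm p)\<^sup>2)
      \<le> objective f \<Psi> x - ereal (\<gamma> * \<alpha>\<^sup>2 * norm p powr (2 + \<delta>))"
    by (simp add: objective_def real)
  then show ?thesis
    using trial_point_properties(2)[OF grad lip \<open>L > 0\<close> \<Psi>, of x p \<alpha>]
      model_descent_step[OF grad lip \<Psi>(1,3) real model H \<alpha>(1,2)]
    unfolding sufficient_decrease_def by (meson order_trans)
next
  \<comment> \<open>With an infinite objective at \<open>x\<close> the right-hand side of the test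
    is infinite, so every step passes.\<close>
  case PInf
  then show ?thesis
    by (simp add: sufficient_decrease_def objective_def)
next
  case MInf
  then show ?thesis
    using \<Psi>(3) by (simp add: proper_fun_def)
qed

section \<open>Backtracking\<close>

lemma line_search_step_sufficient:
  assumes "line_search_halts f gradf \<Psi> L \<beta> \<gamma> \<delta> x p"
  shows "sufficient_decrease f gradf \<Psi> L \<gamma> \<delta> x p (line_search_step f gradf \<Psi> L \<beta> \<gamma> \<delta> x p)"
  using assms unfolding line_search_halts_def line_search_step_def by (rule LeastI_ex)

lemma line_search_haltsI:
  assumes \<beta>: "0 < \<beta>" "\<beta> < 1" and "\<mu> > 0" "K > 0"
    and suff: "\<And>\<alpha>. 0 \<le> \<alpha> \<Longrightarrow> \<alpha> \<le> 1 \<Longrightarrow> \<alpha> * K \<le> \<mu> \<Longrightarrow> sufficient_decrease f gradf \<Psi> L \<gamma> \<delta> x p \<alpha>"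
  shows "line_search_halts f gradf \<Psi> L \<beta> \<gamma> \<delta> x p"
proof -
  obtain i where "\<beta> ^ i < \<mu> / K"
    using real_arch_pow_inv[of "\<mu> / K" \<beta>] assms by auto
  then have "\<beta> ^ i * K \<le> \<mu>"
    using \<open>K > 0\<close> by (simp add: field_simps)
  then show ?thesis
    unfolding line_search_halts_def using \<beta> by (meson suff power_le_one less_imp_le zero_le_power)
qed

text \<open>Unless the first trial is accepted, the trial before the chosen one failed and so
  violates the bound in \<open>suff\<close>; the chosen step is \<open>\<beta>\<close> times that
  trial.\<close>

lemma line_search_step_lower_bound:
  assumes \<beta>: "0 < \<beta>" "\<beta> < 1"
    and suff: "\<And>\<alpha>. 0 \<le> \<alpha> \<Longrightarrow> \<alpha> \<le> 1 \<Longrightarrow> \<alpha> * K \<le> \<mu> \<Longrightarrow> sufficient_decrease f gradf \<Psi> L \<gamma> \<delta> x p \<alpha>"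
  defines "\<alpha> \<equiv> line_search_step f gradf \<Psi> L \<beta> \<gamma> \<delta> x p"
  shows "\<alpha> = 1 \<or> \<beta> * \<mu> \<le> \<alpha> * K"
proof -
  define i where "i = (LEAST i. sufficient_decrease f gradf \<Psi> L \<gamma> \<delta> x p (\<beta> ^ i))"
  have \<alpha>: "\<alpha> = \<beta> ^ i"
    by (simp add: \<alpha>_def line_search_step_def i_def)
  show ?thesis
  proof (cases i)
    case (Suc j)
    then have "\<not> sufficient_decrease f gradf \<Psi> L \<gamma> \<delta> x p (\<beta> ^ j)"
      unfolding i_def by (intro not_less_Least) simp
    then have "\<not> \<beta> ^ j * K \<le> \<mu>"
      using suff \<beta> by (meson power_le_one less_imp_le zero_le_power)
    then have "\<beta> * \<mu> \<le> \<beta> * (\<beta> ^ j * K)"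
      using \<beta> by (intro mult_left_mono) auto
    then show ?thesis
      by (simp add: \<alpha> Suc mult.assoc)
  qed (simp add: \<alpha>)
qed

section \<open>Residuals and the size of the decrease\<close>

text \<open>With \<open>p = y - x\<close>, the two proximal arguments differ by
  \<open>p - H p\<close>, and \<open>prox\<close> does not enlarge this. Replacing \<open>x\<close>
  by \<open>y\<close> outside \<open>prox\<close> costs a second \<open>norm p\<close>.\<close>

lemma residual_le_model_residual:
  fixes \<Psi> :: "'a::{real_inner, complete_space} \<Rightarrow> ereal"
  assumes "convex_fun \<Psi>" "closed_fun \<Psi>" "proper_fun \<Psi>"
  shows "residual gradf \<Psi> x \<le> model_residual gradf \<Psi> H x y + (2 + norm H) * norm (y - x)"
proof -
  define p where "p = y - x"
  let ?u = "prox \<Psi> (x - gradf x)" and ?v = "prox \<Psi> (y - gradf x - blinfun_apply H p)"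
  have "norm (?v - ?u) \<le> norm (p - blinfun_apply H p)"
    using prox_nonexpansive[OF assms, of "y - gradf x - blinfun_apply H p" "x - gradf x"]
    by (simp add: p_def algebra_simps)
  also have "\<dots> \<le> norm p + norm H * norm p"
    using norm_triangle_ineq4[of p "blinfun_apply H p"] norm_blinfun[of H p] by linarith
  finally have "norm (?v - ?u) \<le> norm p + norm H * norm p" .
  moreover have "norm (x - ?u) \<le> norm (y - ?v) + norm (?v - ?u) + norm p"
    using norm_triangle_ineq[of "y - ?v" "?v - ?u"] norm_triangle_ineq4[of "y - ?u" p]
    by (simp add: p_def)
  ultimately show ?thesis
    by (simp add: residual_def model_residual_def p_def[symmetric] algebra_simps)
qed

lemma residual_continuous:
  fixes \<Psi> :: "'a::{real_inner, complete_space} \<Rightarrow> ereal"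
  assumes \<Psi>: "convex_fun \<Psi>" "closed_fun \<Psi>" "proper_fun \<Psi>" and lip: "L-lipschitz_on UNIV gradf"
  shows "continuous_on UNIV (residual gradf \<Psi>)"
proof -
  have "1-lipschitz_on UNIV (prox \<Psi>)"
    by (rule lipschitz_onI) (simp_all add: dist_norm prox_nonexpansive[OF \<Psi>])
  then have "continuous_on UNIV (prox \<Psi>)"
    by (rule lipschitz_on_continuous_on)
  moreover have "continuous_on UNIV (\<lambda>x. x - gradf x)"
    using lipschitz_on_continuous_on[OF lip] by (intro continuous_intros)
  ultimately have "continuous_on UNIV (\<lambda>x. prox \<Psi> (x - gradf x))"
    by (rule continuous_on_compose2) auto
  then have "continuous_on UNIV (\<lambda>x. norm (x - prox \<Psi> (x - gradf x)))"
    by (intro continuous_intros)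
  then show ?thesis
    by (simp add: residual_def[abs_def])
qed

text \<open>Here \<open>P\<close> is the length of the search direction. \<open>K\<close> is chosen
  so that \<open>L + 2 * \<gamma> * P powr \<delta> \<le> K * P powr \<delta>\<close>. A shortened
  step thus has \<open>\<alpha> * P powr \<delta> \<ge> b / K\<close>, and squaring leaves the
  factor \<open>P powr (2 - \<delta>)\<close>, which is monotone because
  \<open>\<delta> \<le> 2\<close>.\<close>

lemma step_size_decrease_lower_bound:
  fixes L \<gamma> \<delta> p\<^sub>0 b \<alpha> P :: real
  defines "K \<equiv> L * p\<^sub>0 powr (- \<delta>) + 2 * \<gamma>"
  assumes "L > 0" "\<gamma> > 0" and \<delta>: "0 \<le> \<delta>" "\<delta> \<le> 2" and P: "0 < p\<^sub>0" "p\<^sub>0 \<le> P" and "b > 0" "\<alpha> > 0"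
    and step: "\<alpha> = 1 \<or> b \<le> \<alpha> * (L + 2 * \<gamma> * P powr \<delta>)"
  shows "min (p\<^sub>0 powr (2 + \<delta>)) ((b / K)\<^sup>2 * p\<^sub>0 powr (2 - \<delta>)) \<le> \<alpha>\<^sup>2 * P powr (2 + \<delta>)"
  using step
proof
  assume "\<alpha> = 1"
  moreover have "p\<^sub>0 powr (2 + \<delta>) \<le> P powr (2 + \<delta>)"
    using P \<delta> by (intro powr_mono2) auto
  ultimately show ?thesis by simp
next
  assume b: "b \<le> \<alpha> * (L + 2 * \<gamma> * P powr \<delta>)"
  have "K > 0"
    using \<open>L > 0\<close> \<open>\<gamma> > 0\<close> by (simp add: K_def add_nonneg_pos)
  have "1 = p\<^sub>0 powr (- \<delta>) * p\<^sub>0 powr \<delta>"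
    using P by (simp add: powr_add[symmetric])
  also have "\<dots> \<le> p\<^sub>0 powr (- \<delta>) * P powr \<delta>"
    using P \<delta> by (intro mult_left_mono powr_mono2) auto
  finally have "L * 1 \<le> L * (p\<^sub>0 powr (- \<delta>) * P powr \<delta>)"
    using \<open>L > 0\<close> by (intro mult_left_mono) auto
  then have "L + 2 * \<gamma> * P powr \<delta> \<le> K * P powr \<delta>"
    by (simp add: K_def algebra_simps)
  then have "\<alpha> * (L + 2 * \<gamma> * P powr \<delta>) \<le> \<alpha> * (K * P powr \<delta>)"
    using \<open>\<alpha> > 0\<close> by (intro mult_left_mono) auto
  with b have "b / K \<le> \<alpha> * P powr \<delta>"
    using \<open>K > 0\<close> by (simp add: field_simps)
  then have "(b / K)\<^sup>2 \<le> (\<alpha> * P powr \<delta>)\<^sup>2"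
    using \<open>K > 0\<close> \<open>b > 0\<close> by (intro power_mono) auto
  moreover have "p\<^sub>0 powr (2 - \<delta>) \<le> P powr (2 - \<delta>)"
    using P \<delta> by (intro powr_mono2) auto
  ultimately have "(b / K)\<^sup>2 * p\<^sub>0 powr (2 - \<delta>) \<le> (\<alpha> * P powr \<delta>)\<^sup>2 * P powr (2 - \<delta>)"
    by (intro mult_mono) auto
  also have "\<dots> = \<alpha>\<^sup>2 * (P powr \<delta> * P powr \<delta> * P powr (2 - \<delta>))"
    by (simp add: power2_eq_square)
  also have "P powr \<delta> * P powr \<delta> * P powr (2 - \<delta>) = P powr (2 + \<delta>)"
    by (simp add: powr_add[symmetric] add.commute)
  finally show ?thesis by simp
qed

text \<open>For \<open>a \<le> 1\<close> the quotient \<open>r powr (a - 1)\<close> is nonincreasing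
  in \<open>r\<close>.\<close>

lemma powr_le_linear:
  fixes r \<epsilon> a :: real
  assumes "0 < \<epsilon>" "\<epsilon> \<le> r" "a \<le> 1"
  shows "r powr a \<le> \<epsilon> powr (a - 1) * r"
proof -
  have "r powr (a - 1) \<le> \<epsilon> powr (a - 1)"
    using assms by (intro powr_mono2') auto
  then have "r powr (a - 1) * r \<le> \<epsilon> powr (a - 1) * r"
    using assms by (intro mult_right_mono) auto
  moreover have "r powr (a - 1) * r = r powr a"
    using assms by (simp add: powr_diff)
  ultimately show ?thesis by simp
qed

theorem lemma3p2:
  fixes f :: "'a::{real_inner, complete_space} \<Rightarrow> real"
    and gradf :: "'a \<Rightarrow> 'a"
    and hessf :: "'a \<Rightarrow> 'a \<Rightarrow>\<^sub>L 'a"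
    and \<Psi> :: "'a \<Rightarrow> ereal"
    and L Fbar \<beta> \<gamma> \<nu> \<rho> c \<delta> \<theta> C :: real
    and J :: "nat \<Rightarrow> 'a \<Rightarrow>\<^sub>L 'a"
    and x xtil :: "nat \<Rightarrow> 'a"
  assumes grad: "\<And>z. GDERIV f z :> gradf z"
    and hess: "\<And>z. (gradf has_derivative blinfun_apply (hessf z)) (at z)"
    and hess_cont: "continuous_on UNIV hessf"
    and L_pos: "L > 0"
    and grad_lipschitz: "L-lipschitz_on UNIV gradf"
    and Psi_convex: "convex_fun \<Psi>"
    and Psi_proper: "proper_fun \<Psi>"
    and Psi_closed: "closed_fun \<Psi>"
    and F_lower_bounded: "\<And>z. ereal Fbar \<le> objective f \<Psi> z"
    and beta: "0 < \<beta>" "\<beta> < 1"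
    and gamma: "0 < \<gamma>" "\<gamma> < 1"
    and nu: "0 \<le> \<nu>" "\<nu> < 1"
    and rho: "0 < \<rho>" "\<rho> \<le> 1"
    and c_pos: "c > 0"
    and delta: "0 \<le> \<delta>" "\<delta> \<le> 2"
    and run: "algorithm_run f gradf \<Psi> L \<beta> \<gamma> \<nu> \<rho> c \<delta> J x xtil"
    and J_symmetric: "\<And>t u v. reached f gradf \<Psi> L \<beta> \<gamma> \<delta> x xtil t \<Longrightarrow>
          inner (blinfun_apply (J t) u) v = inner u (blinfun_apply (J t) v)"
    and J_psd: "\<And>t v. reached f gradf \<Psi> L \<beta> \<gamma> \<delta> x xtil t \<Longrightarrow>
          inner (blinfun_apply (J t) v) v \<ge> 0"
    and theta: "\<rho> \<le> \<theta>" "\<theta> \<le> 1"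
    and J_approx: "\<And>t. reached f gradf \<Psi> L \<beta> \<gamma> \<delta> x xtil t \<Longrightarrow>
          norm (J t - hessf (x t)) \<le> C * residual gradf \<Psi> (x t) powr \<theta>"
  shows "((\<exists>t. terminates_at f gradf \<Psi> L \<beta> \<gamma> \<delta> x xtil t \<and> residual gradf \<Psi> (x t) = 0) \<or>
          (infinite_run f gradf \<Psi> L \<beta> \<gamma> \<delta> x xtil \<and>
           (\<lambda>t. residual gradf \<Psi> (x t)) \<longlonglongrightarrow> 0)) \<and>
         (infinite_run f gradf \<Psi> L \<beta> \<gamma> \<delta> x xtil \<and> stationary_points gradf \<Psi> \<noteq> {} \<longrightarrow>
          (\<forall>z. accumulation_point x z \<longrightarrow> z \<in> stationary_points gradf \<Psi>))"
proof -
  note Psi = Psi_convex Psi_closed Psi_proper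
  define R where "R = reached f gradf \<Psi> L \<beta> \<gamma> \<delta> x xtil"
  define r where "r = (\<lambda>t. residual gradf \<Psi> (x t))"
  define p where "p = (\<lambda>t. xtil (Suc t) - x t)"
  define \<mu> where "\<mu> = (\<lambda>t. c * r t powr \<rho>)"
  define H where "H = (\<lambda>t. reg_hess gradf \<Psi> c \<rho> (J t) (x t))"
  define K where "K = (\<lambda>t. L + 2 * \<gamma> * norm (p t) powr \<delta>)"
  define \<alpha> where "\<alpha> = (\<lambda>t. line_search_step f gradf \<Psi> L \<beta> \<gamma> \<delta> (x t) (p t))"
  define halts where "halts = (\<lambda>t. line_search_halts f gradf \<Psi> L \<beta> \<gamma> \<delta> (x t) (p t))"

  \<comment> \<open>Estimates for a single reached iteration\<close>
  have r_nonneg: "r t \<ge> 0" for t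
    by (simp add: r_def residual_def)
  have K_pos: "K t > 0" for t
    using L_pos gamma by (simp add: K_def add_pos_nonneg)
  have R_Suc: "R (Suc t) \<longleftrightarrow> R t \<and> xtil (Suc t) \<noteq> x t \<and> halts t" for t
    by (auto simp: R_def reached_def halts_def p_def less_Suc_eq)
  have H_apply: "H t = J t + \<mu> t *\<^sub>R id_blinfun" for t
    by (simp add: H_def reg_hess_def \<mu>_def r_def)
  have H_norm: "norm (H t) \<le> L + \<bar>C\<bar> * r t powr \<theta> + c * r t powr \<rho>" if "R t" for t
  proof -
    have "norm (J t) \<le> norm (hessf (x t)) + norm (J t - hessf (x t))"
      by (rule norm_triangle_sub)
    moreover have "norm (hessf (x t)) \<le> L"
      using lipschitz_derivative_norm_le[OF hess grad_lipschitz] .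
    \<comment> \<open>The absolute value is taken because \<open>C\<close> may have either
      sign.\<close>
    moreover have "norm (J t - hessf (x t)) \<le> \<bar>C\<bar> * r t powr \<theta>"
      using J_approx[of t] that mult_right_mono[of C "\<bar>C\<bar>" "r t powr \<theta>"]
      by (fastforce simp: R_def r_def)
    \<comment> \<open>The identity has norm 0 in the zero space, hence an inequality.\<close>
    moreover have "norm (\<mu> t *\<^sub>R (id_blinfun :: 'a \<Rightarrow>\<^sub>L 'a)) \<le> \<mu> t"
      using c_pos by (simp add: \<mu>_def mult_left_le norm_blinfun_id_le)
    ultimately show ?thesis
      using norm_triangle_ineq[of "J t" "\<mu> t *\<^sub>R id_blinfun"] by (simp add: H_apply \<mu>_def)
  qed
  have approx: "approx_minimizer gradf \<Psi> \<nu> \<rho> (H t) (x t) (x t + p t)" if "R t" for t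
    using run that by (simp add: algorithm_run_def R_def H_def p_def)
  \<comment> \<open>The inexactness is at most \<open>\<nu> * r t\<close> and is absorbed on the
    left, so a short step forces a small residual.\<close>
  have step_norm: "(1 - \<nu>) * r t \<le> (2 + norm (H t)) * norm (p t)" if "R t" for t
  proof -
    have "model_residual gradf \<Psi> (H t) (x t) (x t + p t) \<le> \<nu> * min (r t powr (1 + \<rho>)) (r t)"
      using approx[OF that] by (simp add: approx_minimizer_def r_def)
    also have "\<dots> \<le> \<nu> * r t"
      using nu by (intro mult_left_mono) auto
    finally show ?thesis
      using residual_le_model_residual[OF Psi, of gradf "x t" "H t" "x t + p t"]
      by (simp add: r_def algebra_simps)
  qed
  have suff: "sufficient_decrease f gradf \<Psi> L \<gamma> \<delta> (x t) (p t) a"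
    if "R t" "0 \<le> a" "a \<le> 1" "a * K t \<le> \<mu> t" for t a
  proof (rule sufficient_decreaseI[OF grad grad_lipschitz L_pos Psi])
    show "model gradf \<Psi> (H t) (x t) (x t + p t) \<le> model gradf \<Psi> (H t) (x t) (x t)"
      using approx[OF that(1)] by (simp add: approx_minimizer_def)
    show "\<mu> t * (norm (p t))\<^sup>2 \<le> inner (blinfun_apply (H t) (p t)) (p t)"
      using J_psd[of t "p t"] that(1)
      by (simp add: H_apply R_def blinfun.add_left blinfun.scaleR_left inner_add_left power2_norm_eq_inner)
  qed (use that in \<open>auto simp: K_def\<close>)
  have halts: "halts t" if "R t" "xtil (Suc t) \<noteq> x t" for t
  proof (cases "r t = 0")
    \<comment> \<open>Here \<open>\<mu> t\<close> vanishes and \<open>suff\<close> yields no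
      positive step; halting is the last clause of \<open>algorithm_run\<close>.\<close>
    case True
    then show ?thesis
      using run that by (simp add: algorithm_run_def R_def halts_def p_def r_def)
  next
    case False
    then have "\<mu> t > 0"
      using c_pos by (simp add: \<mu>_def)
    then show ?thesis
      unfolding halts_def using suff[OF that(1)] by (intro line_search_haltsI[OF beta _ K_pos])
  qed

  \<comment> \<open>Infinite runs: the residual tends to zero\<close>
  have infinite: "r \<longlonglongrightarrow> 0" if all_R: "\<And>t. R t"
  proof -
    \<comment> \<open>If the objective is infinite at \<open>x 0\<close>, then \<open>F 0\<close> is
      the default value 0; all estimates below therefore start at \<open>F (Suc 0)\<close>.\<close>
    define F where "F = (\<lambda>t. real_of_ereal (objective f \<Psi> (x t)))"
    define G where "G = (\<lambda>t. (\<alpha> t)\<^sup>2 * norm (p t) powr (2 + \<delta>))"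
    have x_Suc: "x (Suc t) = trial_point gradf \<Psi> L (x t) (p t) (\<alpha> t)" for t
      using run all_R by (simp add: algorithm_run_def R_def \<alpha>_def p_def)
    have F: "objective f \<Psi> (x (Suc t)) = ereal (F (Suc t))" for t
      using trial_point_properties(1)[OF grad grad_lipschitz L_pos Psi, of "x t" "p t" "\<alpha> t"] Psi_proper
      by (cases "\<Psi> (x (Suc t))") (auto simp: F_def objective_def x_Suc proper_fun_def)
    have decrease: "\<gamma> * G (Suc t) \<le> F (Suc t) - F (Suc (Suc t))" for t
    proof -
      have "halts (Suc t)"
        using all_R R_Suc by blast
      then have "sufficient_decrease f gradf \<Psi> L \<gamma> \<delta> (x (Suc t)) (p (Suc t)) (\<alpha> (Suc t))"
        unfolding halts_def \<alpha>_def by (rule line_search_step_sufficient)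
      then show ?thesis
        by (simp add: sufficient_decrease_def x_Suc[symmetric] F G_def algebra_simps)
    qed
    have G_nonneg: "0 \<le> G t" for t
      by (simp add: G_def)
    have dec: "decseq (\<lambda>t. F (Suc t))"
    proof (rule decseq_SucI)
      fix t
      have "0 \<le> \<gamma> * G (Suc t)"
        using gamma G_nonneg by simp
      then show "F (Suc (Suc t)) \<le> F (Suc t)"
        using decrease[of t] by linarith
    qed
    have "\<forall>t. Fbar \<le> F (Suc t)"
      using F_lower_bounded F by (metis ereal_less_eq(3))
    then obtain l where l: "(\<lambda>t. F (Suc t)) \<longlonglongrightarrow> l"
      using decseq_convergent[OF dec] by blast
    \<comment> \<open>Since \<open>F\<close> converges, its consecutive differences vanish in the
      limit and squeeze \<open>G\<close> to zero.\<close>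
    have "(\<lambda>t. (F (Suc t) - F (Suc (Suc t))) / \<gamma>) \<longlonglongrightarrow> (l - l) / \<gamma>"
      using gamma by (intro tendsto_intros l LIMSEQ_Suc[OF l]) simp
    then have "(\<lambda>t. G (Suc t)) \<longlonglongrightarrow> 0"
      using decrease G_nonneg gamma
      by (intro tendsto_sandwich[of "\<lambda>_. 0" "\<lambda>t. G (Suc t)" _ "\<lambda>t. (F (Suc t) - F (Suc (Suc t))) / \<gamma>"])
         (auto simp: field_simps)
    then have G_lim: "G \<longlonglongrightarrow> 0"
      by (rule LIMSEQ_imp_Suc)
    have G_lower: "\<exists>\<kappa>>0. \<forall>t. r t \<ge> \<epsilon> \<longrightarrow> \<kappa> \<le> G t" if "\<epsilon> > 0" for \<epsilon>
    \<comment> \<open>As \<open>\<rho>, \<theta> \<le> 1\<close>, \<open>\<parallel>H\<parallel>\<close> grows at most linearly in \<open>r\<close>, so \<open>\<parallel>p\<parallel> \<ge> p\<^sub>0\<close> even for unbounded \<open>r\<close>.\<close>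
    proof -
      \<comment> \<open>\<open>B\<close> is the slope in \<open>2 + norm (H t) \<le> B * r t\<close>
        for \<open>r t \<ge> \<epsilon>\<close>; \<open>p\<^sub>0\<close> is the resulting lower
        bound for the step length, and \<open>b\<close> bounds \<open>\<beta> * \<mu> t\<close> from
        below.\<close>
      define B where "B = (2 + L) / \<epsilon> + \<bar>C\<bar> * \<epsilon> powr (\<theta> - 1) + c * \<epsilon> powr (\<rho> - 1)"
      define p\<^sub>0 where "p\<^sub>0 = (1 - \<nu>) / B"
      define b where "b = \<beta> * (c * \<epsilon> powr \<rho>)"
      define \<kappa> where "\<kappa> = min (p\<^sub>0 powr (2 + \<delta>)) ((b / (L * p\<^sub>0 powr (- \<delta>) + 2 * \<gamma>))\<^sup>2 * p\<^sub>0 powr (2 - \<delta>))"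
      have B: "B > 0"
        using L_pos c_pos \<open>\<epsilon> > 0\<close> by (auto simp: B_def intro!: add_pos_nonneg)
      have p0: "p\<^sub>0 > 0"
        using nu B by (simp add: p\<^sub>0_def)
      have b: "b > 0"
        using beta c_pos \<open>\<epsilon> > 0\<close> by (simp add: b_def)
      have "L * p\<^sub>0 powr (- \<delta>) + 2 * \<gamma> > 0"
        using L_pos gamma by (simp add: add_nonneg_pos)
      then have "\<kappa> > 0"
        using p0 b by (simp add: \<kappa>_def)
      moreover have "\<kappa> \<le> G t" if rt: "r t \<ge> \<epsilon>" for t
        unfolding \<kappa>_def G_def
      proof (rule step_size_decrease_lower_bound[OF L_pos gamma(1) delta p0 _ b])
        have "2 + L \<le> (2 + L) / \<epsilon> * r t"
          using rt \<open>\<epsilon> > 0\<close> L_pos mult_left_mono[OF rt, of "2 + L"] by (simp add: field_simps)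
        moreover have "\<bar>C\<bar> * r t powr \<theta> \<le> \<bar>C\<bar> * (\<epsilon> powr (\<theta> - 1) * r t)"
          using rt \<open>\<epsilon> > 0\<close> theta by (intro mult_left_mono powr_le_linear) auto
        moreover have "c * r t powr \<rho> \<le> c * (\<epsilon> powr (\<rho> - 1) * r t)"
          using rt \<open>\<epsilon> > 0\<close> rho c_pos by (intro mult_left_mono powr_le_linear) auto
        ultimately have "2 + norm (H t) \<le> B * r t"
          using H_norm[OF all_R, of t] by (simp add: B_def algebra_simps)
        then have "(2 + norm (H t)) * norm (p t) \<le> B * r t * norm (p t)"
          by (rule mult_right_mono) simp
        \<comment> \<open>The residual cancels here, so the lower bound on \<open>norm (p t)\<close>
          is uniform in \<open>t\<close>.\<close>
        then have "r t * (1 - \<nu>) \<le> r t * (B * norm (p t))"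
          using step_norm[OF all_R, of t] by (simp add: algebra_simps)
        then have "1 - \<nu> \<le> B * norm (p t)"
          by (rule mult_left_le_imp_le) (use rt \<open>\<epsilon> > 0\<close> in linarith)
        then show "p\<^sub>0 \<le> norm (p t)"
          using B by (simp add: p\<^sub>0_def field_simps)
        show "\<alpha> t > 0"
          using beta by (simp add: \<alpha>_def line_search_step_def)
        have "\<alpha> t = 1 \<or> \<beta> * \<mu> t \<le> \<alpha> t * K t"
          unfolding \<alpha>_def using suff[OF all_R] by (intro line_search_step_lower_bound[OF beta])
        moreover have "b \<le> \<beta> * \<mu> t"
          unfolding b_def \<mu>_def using beta c_pos rho rt \<open>\<epsilon> > 0\<close>
          by (intro mult_left_mono powr_mono2) auto
        ultimately show "\<alpha> t = 1 \<or> b \<le> \<alpha> t * (L + 2 * \<gamma> * norm (p t) powr \<delta>)"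
          unfolding K_def by linarith
      qed
      ultimately show ?thesis by blast
    qed
    have "\<forall>\<^sub>F t in sequentially. r t < \<epsilon>" if "\<epsilon> > 0" for \<epsilon>
    proof -
      obtain \<kappa> where "\<kappa> > 0" and \<kappa>: "\<And>t. r t \<ge> \<epsilon> \<Longrightarrow> \<kappa> \<le> G t"
        using G_lower[OF \<open>\<epsilon> > 0\<close>] by blast
      have "\<forall>\<^sub>F t in sequentially. G t < \<kappa>"
        using G_lim \<open>\<kappa> > 0\<close> by (rule order_tendstoD)
      then show ?thesis
        by eventually_elim (meson \<kappa> not_le)
    qed
    then show ?thesis
      using r_nonneg by (simp add: tendsto_iff)
  qed

  \<comment> \<open>Termination or an infinite run\<close>
  have "(\<exists>t. terminates_at f gradf \<Psi> L \<beta> \<gamma> \<delta> x xtil t \<and> r t = 0) \<or>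
        (infinite_run f gradf \<Psi> L \<beta> \<gamma> \<delta> x xtil \<and> r \<longlonglongrightarrow> 0)"
  proof (cases "\<forall>t. R t")
    case True
    then show ?thesis
      using infinite by (simp add: infinite_run_def R_def)
  next
    case False
    moreover have "R 0"
      by (simp add: R_def reached_def)
    \<comment> \<open>The last reached iteration. By \<open>halts\<close> the line search cannot be
      what stops the run, so the search direction is zero, and \<open>step_norm\<close> then forces
      a zero residual.\<close>
    ultimately obtain t where t: "R t" "\<not> R (Suc t)"
      using nat_induct[of R] by blast
    then have stop: "xtil (Suc t) = x t"
      using R_Suc halts by blast
    then have "(1 - \<nu>) * r t \<le> 0"
      using step_norm[OF t(1)] by (simp add: p_def)
    then have "r t = 0"
      using nu r_nonneg[of t] by (simp add: mult_le_0_iff)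
    then show ?thesis
      using t(1) stop by (auto simp: terminates_at_def R_def)
  qed

  \<comment> \<open>Accumulation points\<close>
  moreover have "z \<in> stationary_points gradf \<Psi>"
    if inf: "infinite_run f gradf \<Psi> L \<beta> \<gamma> \<delta> x xtil" and acc: "accumulation_point x z" for z
  proof -
    obtain s where s: "strict_mono s" "(x \<circ> s) \<longlonglongrightarrow> z"
      using acc by (auto simp: accumulation_point_def)
    have "isCont (residual gradf \<Psi>) z"
      using residual_continuous[OF Psi grad_lipschitz] by (simp add: continuous_on_eq_continuous_at)
    then have "(\<lambda>n. residual gradf \<Psi> ((x \<circ> s) n)) \<longlonglongrightarrow> residual gradf \<Psi> z"
      using s(2) by (rule isCont_tendsto_compose)
    moreover have "(\<lambda>n. residual gradf \<Psi> ((x \<circ> s) n)) = r \<circ> s"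
      by (simp add: r_def o_def)
    ultimately have "(r \<circ> s) \<longlonglongrightarrow> residual gradf \<Psi> z"
      by simp
    moreover have "r \<longlonglongrightarrow> 0"
      using inf by (intro infinite) (simp add: infinite_run_def R_def)
    then have "(r \<circ> s) \<longlonglongrightarrow> 0"
      using s(1) by (rule LIMSEQ_subseq_LIMSEQ)
    ultimately have "residual gradf \<Psi> z = 0"
      by (rule LIMSEQ_unique)
    then show ?thesis
      by (simp add: stationary_points_def)
  qed
  ultimately show ?thesis
    by (auto simp: r_def)
qed

end
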